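(* Let $G$ and $H$ be groups with finite generating sets $S_0$ and $T_0$ respectively, and let $q\colon\Gamma(G,S_0)\to\Gamma(H,T_0)$ be a quasi-isometry. Let $T\subset H$ be a subset containing $T_0$. The following statements are equivalent: (1) The quasi-action of $G$ on $H$ induced by $q$ is uniform with respect to $T$. (2) There is $S\subset G$ containing $S_0$ such that $q\colon\Gamma(G,S)\to\Gamma(H,T)$ is a quasi-isometry.
   Context: For a generating set $S$ (possibly infinite) of a group $G$, $\Gamma(G,S)$ is the Cayley graph, with vertex set $G$ and edges $\{g,gs\}$ ($g\in G$, $s\in S$); a map $q\colon G\to H$ is called a quasi-isometry $\Gamma(G,S)\to\Gamma(H,T)$ if it is a quasi-isometry for the word metrics $\mathrm{dist}_{(G,S)}$, $\mathrm{dist}_{(H,T)}$. Uniform induced quasi-action: let $q\colon G\to H$ be a quasi-isometry of finitely generated groups (with word metrics from finite generating sets) with quasi-inverse $\bar q\colon H\to G$, and let $T\subset H$ be a (possibly infinite) generating set. The quasi-action of $G$ on $H$ induced by $q$ is uniform with respect to $T$ if there are constants $L\ge1$, $C\ge0$ such that for each $g\in G$ the function $q_g\colon H\to H$, $q_g(h)=q(g\cdot\bar q(h))$, is an $(L,C)$-quasi-isometry $\Gamma(H,T)\to\Gamma(H,T)$. *)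

theory Defs
  imports Complex_Main "HOL-Algebra.Generated_Groups"
begin

definition generating_set :: "('a, 'm) monoid_scheme \<Rightarrow> 'a set \<Rightarrow> bool" where
  "generating_set G S \<longleftrightarrow> S \<subseteq> carrier G \<and> generate G S = carrier G"

(* Meaningful when S generates G: otherwise the set of admissible n may be empty
   and LEAST yields an unspecified value. *)
definition word_length :: "('a, 'm) monoid_scheme \<Rightarrow> 'a set \<Rightarrow> 'a \<Rightarrow> nat" where
  "word_length G S x =
     (LEAST n. \<exists>ws. length ws = n \<and> set ws \<subseteq> S \<union> (\<lambda>s. inv\<^bsub>G\<^esub> s) ` S \<and>
                   foldr (\<lambda>a b. a \<otimes>\<^bsub>G\<^esub> b) ws \<one>\<^bsub>G\<^esub> = x)"

definition word_dist :: "('a, 'm) monoid_scheme \<Rightarrow> 'a set \<Rightarrow> 'a \<Rightarrow> 'a \<Rightarrow> real" where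
  "word_dist G S g h = real (word_length G S (inv\<^bsub>G\<^esub> g \<otimes>\<^bsub>G\<^esub> h))"

definition cayley_edges :: "('a, 'm) monoid_scheme \<Rightarrow> 'a set \<Rightarrow> 'a set set" where
  "cayley_edges G S = {{g, g \<otimes>\<^bsub>G\<^esub> s} | g s. g \<in> carrier G \<and> s \<in> S}"

lemma (in group) cayley_edge_iff:
  assumes "S \<subseteq> carrier G" "g \<in> carrier G"
  shows "{g, h} \<in> cayley_edges G S \<longleftrightarrow> (\<exists>s\<in>S \<union> (\<lambda>s. inv s) ` S. h = g \<otimes> s)"
proof
  assume "{g, h} \<in> cayley_edges G S"
  then obtain k s where ks: "k \<in> carrier G" "s \<in> S" "{g, h} = {k, k \<otimes> s}"
    unfolding cayley_edges_def by auto
  then have s: "s \<in> carrier G" using assms(1) by auto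
  from ks(3) consider "g = k" "h = k \<otimes> s" | "g = k \<otimes> s" "h = k"
    by (auto simp: doubleton_eq_iff)
  then show "\<exists>s\<in>S \<union> (\<lambda>s. inv s) ` S. h = g \<otimes> s"
  proof cases
    case 2
    then have "h = g \<otimes> inv s" using ks(1) s by (simp add: m_assoc)
    then show ?thesis using ks(2) by blast
  qed (use ks in blast)
next
  assume "\<exists>s\<in>S \<union> (\<lambda>s. inv s) ` S. h = g \<otimes> s"
  then consider s where "s \<in> S" "h = g \<otimes> s" | s where "s \<in> S" "h = g \<otimes> inv s" by blast
  then show "{g, h} \<in> cayley_edges G S"
  proof cases
    case 1
    then show ?thesis unfolding cayley_edges_def using assms by blast
  next
    case (2 s)
    then have "s \<in> carrier G" using assms(1) by auto
    then have "h \<in> carrier G" "g = h \<otimes> s" using 2 assms(2) by (simp_all add: m_assoc)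
    then have "{g, h} = {h, h \<otimes> s}" by auto
    then show ?thesis unfolding cayley_edges_def using 2 \<open>h \<in> carrier G\<close> by blast
  qed
qed

lemma (in group) word_iff_cayley_path:
  assumes S: "S \<subseteq> carrier G" and "g \<in> carrier G" "h \<in> carrier G"
  shows "(\<exists>ws. length ws = n \<and> set ws \<subseteq> S \<union> (\<lambda>s. inv s) ` S \<and>
                foldr (\<lambda>a b. a \<otimes> b) ws \<one> = inv g \<otimes> h) \<longleftrightarrow>
         (\<exists>p :: nat \<Rightarrow> 'a. p 0 = g \<and> p n = h \<and> (\<forall>i<n. {p i, p (Suc i)} \<in> cayley_edges G S))"
  using assms(2,3)
proof (induction n arbitrary: g)
  case 0
  have "\<one> = inv g \<otimes> h \<longleftrightarrow> g = h"
    using 0 by (metis inv_equality inv_inv inv_closed l_inv)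
  then show ?case by auto
next
  case (Suc n)
  let ?A = "S \<union> (\<lambda>s. inv s) ` S"
  have A: "?A \<subseteq> carrier G" using S by auto
  have car: "foldr (\<lambda>a b. a \<otimes> b) ws \<one> \<in> carrier G" if "set ws \<subseteq> ?A" for ws
    using that A by (induction ws) auto
  have cancel: "a \<otimes> f = inv g \<otimes> h \<longleftrightarrow> f = inv (g \<otimes> a) \<otimes> h"
    if "a \<in> carrier G" "f \<in> carrier G" for a f
    using that Suc.prems by (metis inv_solve_left inv_mult_group m_assoc inv_closed m_closed)
  have "(\<exists>ws. length ws = Suc n \<and> set ws \<subseteq> ?A \<and> foldr (\<lambda>a b. a \<otimes> b) ws \<one> = inv g \<otimes> h) \<longleftrightarrow>
        (\<exists>a\<in>?A. \<exists>ws. length ws = n \<and> set ws \<subseteq> ?A \<and> a \<otimes> foldr (\<lambda>a b. a \<otimes> b) ws \<one> = inv g \<otimes> h)"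
    (is "?l \<longleftrightarrow> ?r")
  proof
    assume ?l
    then obtain ws where ws: "length ws = Suc n" "set ws \<subseteq> ?A" "foldr (\<lambda>a b. a \<otimes> b) ws \<one> = inv g \<otimes> h"
      by blast
    then obtain a vs where "ws = a # vs" by (cases ws) auto
    then show ?r using ws by (intro bexI[of _ a] exI[of _ vs]) auto
  next
    assume ?r
    then obtain a vs where "a \<in> ?A" "length vs = n" "set vs \<subseteq> ?A"
      "a \<otimes> foldr (\<lambda>a b. a \<otimes> b) vs \<one> = inv g \<otimes> h" by blast
    then show ?l by (intro exI[of _ "a # vs"]) auto
  qed
  also have "\<dots> \<longleftrightarrow> (\<exists>a\<in>?A. \<exists>ws. length ws = n \<and> set ws \<subseteq> ?A \<and>
                        foldr (\<lambda>a b. a \<otimes> b) ws \<one> = inv (g \<otimes> a) \<otimes> h)"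
    using cancel A car by (meson subsetD)
  also have "\<dots> \<longleftrightarrow> (\<exists>a\<in>?A. \<exists>p. p 0 = g \<otimes> a \<and> p n = h \<and> (\<forall>i<n. {p i, p (Suc i)} \<in> cayley_edges G S))"
    using Suc A by (intro bex_cong refl Suc.IH) auto
  also have "\<dots> \<longleftrightarrow> (\<exists>p. p 0 = g \<and> p (Suc n) = h \<and> (\<forall>i<Suc n. {p i, p (Suc i)} \<in> cayley_edges G S))"
  proof
    assume "\<exists>a\<in>?A. \<exists>p. p 0 = g \<otimes> a \<and> p n = h \<and> (\<forall>i<n. {p i, p (Suc i)} \<in> cayley_edges G S)"
    then obtain a p where ap: "a \<in> ?A" "p 0 = g \<otimes> a" "p n = h"
      "\<forall>i<n. {p i, p (Suc i)} \<in> cayley_edges G S" by blast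
    have e: "{g, p 0} \<in> cayley_edges G S" using cayley_edge_iff[OF S] Suc.prems ap(1,2) by blast
    show "\<exists>p. p 0 = g \<and> p (Suc n) = h \<and> (\<forall>i<Suc n. {p i, p (Suc i)} \<in> cayley_edges G S)"
      by (rule exI[of _ "case_nat g p"]) (use ap e in \<open>auto split: nat.split\<close>)
  next
    assume "\<exists>p. p 0 = g \<and> p (Suc n) = h \<and> (\<forall>i<Suc n. {p i, p (Suc i)} \<in> cayley_edges G S)"
    then obtain p where p: "p 0 = g" "p (Suc n) = h"
      "\<forall>i<Suc n. {p i, p (Suc i)} \<in> cayley_edges G S" by blast
    then have "{g, p 1} \<in> cayley_edges G S" by force
    then obtain a where "a \<in> ?A" "p 1 = g \<otimes> a" using cayley_edge_iff[OF S] Suc.prems by blast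
    then show "\<exists>a\<in>?A. \<exists>p. p 0 = g \<otimes> a \<and> p n = h \<and> (\<forall>i<n. {p i, p (Suc i)} \<in> cayley_edges G S)"
      using p by (intro bexI[of _ a] exI[of _ "\<lambda>i. p (Suc i)"]) auto
  qed
  finally show ?case .
qed

lemma (in group) word_dist_eq_cayley_graph_dist:
  assumes "S \<subseteq> carrier G" "g \<in> carrier G" "h \<in> carrier G"
  shows "word_dist G S g h =
    real (LEAST n. \<exists>p :: nat \<Rightarrow> 'a. p 0 = g \<and> p n = h \<and>
                     (\<forall>i<n. {p i, p (Suc i)} \<in> cayley_edges G S))"
  unfolding word_dist_def word_length_def word_iff_cayley_path[OF assms] ..

definition LC_quasi_isometry ::
  "real \<Rightarrow> real \<Rightarrow> 'a set \<Rightarrow> ('a \<Rightarrow> 'a \<Rightarrow> real) \<Rightarrow> 'b set \<Rightarrow> ('b \<Rightarrow> 'b \<Rightarrow> real) \<Rightarrow> ('a \<Rightarrow> 'b) \<Rightarrow> bool" where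
  "LC_quasi_isometry L C X dX Y dY f \<longleftrightarrow>
     f \<in> X \<rightarrow> Y \<and>
     (\<forall>x\<in>X. \<forall>x'\<in>X. dX x x' / L - C \<le> dY (f x) (f x') \<and> dY (f x) (f x') \<le> L * dX x x' + C) \<and>
     (\<forall>y\<in>Y. \<exists>x\<in>X. dY (f x) y \<le> C)"

definition quasi_isometry ::
  "'a set \<Rightarrow> ('a \<Rightarrow> 'a \<Rightarrow> real) \<Rightarrow> 'b set \<Rightarrow> ('b \<Rightarrow> 'b \<Rightarrow> real) \<Rightarrow> ('a \<Rightarrow> 'b) \<Rightarrow> bool" where
  "quasi_isometry X dX Y dY f \<longleftrightarrow> (\<exists>L\<ge>1. \<exists>C\<ge>0. LC_quasi_isometry L C X dX Y dY f)"

(* For a quasi-isometry f, any f' satisfying this is itself a quasi-isometry,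
   so that requirement is not listed separately. *)
definition quasi_inverse ::
  "'a set \<Rightarrow> ('a \<Rightarrow> 'a \<Rightarrow> real) \<Rightarrow> 'b set \<Rightarrow> ('b \<Rightarrow> 'b \<Rightarrow> real) \<Rightarrow> ('a \<Rightarrow> 'b) \<Rightarrow> ('b \<Rightarrow> 'a) \<Rightarrow> bool" where
  "quasi_inverse X dX Y dY f f' \<longleftrightarrow>
     f' \<in> Y \<rightarrow> X \<and>
     (\<exists>D. (\<forall>x\<in>X. dX (f' (f x)) x \<le> D) \<and> (\<forall>y\<in>Y. dY (f (f' y)) y \<le> D))"

abbreviation cayley_quasi_isometry ::
  "('a, 'm) monoid_scheme \<Rightarrow> 'a set \<Rightarrow> ('b, 'n) monoid_scheme \<Rightarrow> 'b set \<Rightarrow> ('a \<Rightarrow> 'b) \<Rightarrow> bool" where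
  "cayley_quasi_isometry G S H T q \<equiv>
     quasi_isometry (carrier G) (word_dist G S) (carrier H) (word_dist H T) q"

definition induced_quasi_action ::
  "('a, 'm) monoid_scheme \<Rightarrow> ('a \<Rightarrow> 'b) \<Rightarrow> ('b \<Rightarrow> 'a) \<Rightarrow> 'a \<Rightarrow> 'b \<Rightarrow> 'b" where
  "induced_quasi_action G q qbar g h = q (g \<otimes>\<^bsub>G\<^esub> qbar h)"

definition uniform_induced_quasi_action ::
  "('a, 'm) monoid_scheme \<Rightarrow> ('b, 'n) monoid_scheme \<Rightarrow> ('a \<Rightarrow> 'b) \<Rightarrow> ('b \<Rightarrow> 'a) \<Rightarrow> 'b set \<Rightarrow> bool" where
  "uniform_induced_quasi_action G H q qbar T \<longleftrightarrow>
     (\<exists>L\<ge>1. \<exists>C\<ge>0. \<forall>g\<in>carrier G.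
        LC_quasi_isometry L C (carrier H) (word_dist H T) (carrier H) (word_dist H T)
          (induced_quasi_action G q qbar g))"

end

theory Submission imports Defs begin

text \<open>
  Only two facts about word metrics enter: they are left-invariant, and a map out of a Cayley graph
  is Lipschitz as soon as it displaces the end points of every edge by a bounded amount
  (\<open>word_dist_lipschitz_of_edges\<close>). Enlarging a generating set can only shrink distances, so \<open>q\<close>
  and \<open>qbar\<close> stay coarsely inverse to each other for every \<open>S \<supseteq> S0\<close> and \<open>T \<supseteq> T0\<close>.

  Suppose that \<open>q\<close> is a quasi-isometry for \<open>S\<close> and \<open>T\<close>. Left translation by \<open>g\<close> is an isometry for
  \<open>S\<close>, so \<open>h \<mapsto> q (g \<cdot> qbar h)\<close> is a composition of quasi-isometries with an isometry, and the
  resulting constants do not see \<open>g\<close> (\<open>uniform_of_quasi_isometry\<close>).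

  Conversely, suppose that the quasi-action is uniform. Let \<open>S\<close> consist of all \<open>s\<close> whose right
  translation moves every point by at most \<open>K\<close> after applying \<open>q\<close>
  (\<open>bounded_displacement\<close>). By construction \<open>q\<close> is \<open>K\<close>-Lipschitz from \<open>S\<close> to \<open>T\<close>. In the
  other direction, let \<open>h\<close> and \<open>h t\<close> be adjacent in the Cayley graph of \<open>T\<close> and put
  \<open>s = (qbar h)\<inverse> (qbar (h t))\<close>. For every \<open>k\<close>, the points \<open>q k\<close> and \<open>q (k s)\<close> are
  the images of \<open>h\<close> and \<open>h t\<close> under the quasi-action of the single element \<open>k (qbar h)\<inverse>\<close>;
  uniformity bounds their distance by a constant, so \<open>s\<close> belongs to \<open>S\<close> once \<open>K\<close> is large enough.
  Hence \<open>qbar\<close> is 1-Lipschitz from \<open>T\<close> to \<open>S\<close>, and a map with a Lipschitz coarse inverse satisfies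
  the lower quasi-isometry inequality (\<open>quasi_isometry_of_uniform\<close>).
\<close>

section \<open>Word metrics\<close>

abbreviation word_product :: "('a, 'm) monoid_scheme \<Rightarrow> 'a list \<Rightarrow> 'a" where
  "word_product G ws \<equiv> foldr (\<lambda>a b. a \<otimes>\<^bsub>G\<^esub> b) ws \<one>\<^bsub>G\<^esub>"

abbreviation letters :: "('a, 'm) monoid_scheme \<Rightarrow> 'a set \<Rightarrow> 'a set" where
  "letters G S \<equiv> S \<union> (\<lambda>s. inv\<^bsub>G\<^esub> s) ` S"

lemma word_length_le:
  assumes "set ws \<subseteq> letters G S"
  shows "word_length G S (word_product G ws) \<le> length ws"
  unfolding word_length_def by (rule Least_le) (use assms in blast)

context group
begin

lemma word_product_closed:
  assumes "S \<subseteq> carrier G" "set ws \<subseteq> letters G S"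
  shows "word_product G ws \<in> carrier G"
  using assms(2) by (induction ws) (use assms(1) in auto)

lemma word_product_append:
  assumes S: "S \<subseteq> carrier G" and "set us \<subseteq> letters G S" "set vs \<subseteq> letters G S"
  shows "word_product G (us @ vs) = word_product G us \<otimes> word_product G vs"
  using assms(2)
proof (induction us)
  case Nil
  then show ?case using word_product_closed[OF S assms(3)] by simp
next
  case (Cons a us)
  then have "a \<in> carrier G" "set us \<subseteq> letters G S" using S by auto
  then show ?case
    using Cons word_product_closed[OF S assms(3)] word_product_closed[OF S, of us]
    by (simp add: m_assoc)
qed

lemma word_product_rev_inv:
  assumes S: "S \<subseteq> carrier G" and "set ws \<subseteq> letters G S"
  shows "set (rev (map (\<lambda>a. inv a) ws)) \<subseteq> letters G S \<and>
         word_product G (rev (map (\<lambda>a. inv a) ws)) = inv (word_product G ws)"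
  using assms(2)
proof (induction ws)
  case Nil
  then show ?case by simp
next
  case (Cons a ws)
  let ?r = "rev (map (\<lambda>a. inv a) ws)"
  have a: "a \<in> carrier G" and ws: "set ws \<subseteq> letters G S" using Cons.prems S by auto
  have ia: "set [inv a] \<subseteq> letters G S" using Cons.prems S by auto
  have IH: "set ?r \<subseteq> letters G S" "word_product G ?r = inv (word_product G ws)"
    using Cons.IH ws by auto
  have "word_product G (?r @ [inv a]) = inv (word_product G ws) \<otimes> inv a"
    using word_product_append[OF S IH(1) ia] IH(2) a by simp
  then show ?case
    using IH(1) ia a word_product_closed[OF S ws] by (simp add: inv_mult_group)
qed

lemma exists_word:
  assumes gen: "generating_set G S" and "x \<in> carrier G"
  shows "\<exists>ws. set ws \<subseteq> letters G S \<and> word_product G ws = x"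
proof -
  have S: "S \<subseteq> carrier G" and "x \<in> generate G S"
    using assms by (auto simp: generating_set_def)
  from this(2) show ?thesis
  proof induction
    case one
    show ?case by (rule exI[of _ "[]"]) simp
  next
    case (incl s)
    then show ?case using S by (intro exI[of _ "[s]"]) auto
  next
    case (inv s)
    then show ?case using S by (intro exI[of _ "[inv s]"]) auto
  next
    case (eng x y)
    then obtain us vs where "set us \<subseteq> letters G S" "word_product G us = x"
      "set vs \<subseteq> letters G S" "word_product G vs = y" by blast
    then show ?case
      using word_product_append[OF S, of us vs] by (intro exI[of _ "us @ vs"]) auto
  qed
qed

lemma geodesic_word:
  assumes "generating_set G S" "x \<in> carrier G"
  obtains ws where "length ws = word_length G S x" "set ws \<subseteq> letters G S" "word_product G ws = x"
proof -
  have "\<exists>n ws. length ws = n \<and> set ws \<subseteq> letters G S \<and> word_product G ws = x"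
    using exists_word[OF assms] by blast
  from LeastI_ex[OF this] show ?thesis
    using that unfolding word_length_def by blast
qed

lemma generating_set_superset:
  assumes "generating_set G S" "S \<subseteq> S'" "S' \<subseteq> carrier G"
  shows "generating_set G S'"
  using assms mono_generate[OF assms(2)] generate_in_carrier[OF assms(3)]
  by (auto simp: generating_set_def)

lemma word_length_mono:
  assumes "generating_set G S" "S \<subseteq> S'" "x \<in> carrier G"
  shows "word_length G S' x \<le> word_length G S x"
proof -
  obtain ws where ws: "length ws = word_length G S x" "set ws \<subseteq> letters G S" "word_product G ws = x"
    using geodesic_word[OF assms(1,3)] .
  have "set ws \<subseteq> letters G S'" using ws(2) assms(2) by blast
  from word_length_le[OF this] show ?thesis using ws by simp
qed

lemma word_length_mult:
  assumes gen: "generating_set G S" and "x \<in> carrier G" "y \<in> carrier G"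
  shows "word_length G S (x \<otimes> y) \<le> word_length G S x + word_length G S y"
proof -
  have S: "S \<subseteq> carrier G" using gen by (simp add: generating_set_def)
  obtain us where us: "length us = word_length G S x" "set us \<subseteq> letters G S" "word_product G us = x"
    using geodesic_word[OF gen assms(2)] .
  obtain vs where vs: "length vs = word_length G S y" "set vs \<subseteq> letters G S" "word_product G vs = y"
    using geodesic_word[OF gen assms(3)] .
  have "set (us @ vs) \<subseteq> letters G S" using us vs by simp
  from word_length_le[OF this] show ?thesis
    using word_product_append[OF S us(2) vs(2)] us vs by simp
qed

lemma word_length_inv_le:
  assumes gen: "generating_set G S" and "x \<in> carrier G"
  shows "word_length G S (inv x) \<le> word_length G S x"
proof -
  have S: "S \<subseteq> carrier G" using gen by (simp add: generating_set_def)
  obtain ws where ws: "length ws = word_length G S x" "set ws \<subseteq> letters G S" "word_product G ws = x"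
    using geodesic_word[OF gen assms(2)] .
  note r = word_product_rev_inv[OF S ws(2)]
  from word_length_le[OF conjunct1[OF r]] show ?thesis using r ws by simp
qed

lemma word_length_generator:
  assumes "generating_set G S" "s \<in> S"
  shows "word_length G S s \<le> 1"
proof -
  have "s \<in> carrier G" using assms by (auto simp: generating_set_def)
  then show ?thesis using word_length_le[of "[s]" S G] assms(2) by simp
qed

lemma word_dist_mono:
  assumes "generating_set G S" "S \<subseteq> S'" "g \<in> carrier G" "h \<in> carrier G"
  shows "word_dist G S' g h \<le> word_dist G S g h"
  unfolding word_dist_def using word_length_mono[OF assms(1,2)] assms(3,4) by simp

lemma word_dist_self:
  assumes "g \<in> carrier G"
  shows "word_dist G S g g = 0"
  using word_length_le[of "[]" S G] assms by (simp add: word_dist_def)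

lemma word_dist_sym:
  assumes "generating_set G S" "g \<in> carrier G" "h \<in> carrier G"
  shows "word_dist G S g h = word_dist G S h g"
proof -
  have "word_length G S (inv a \<otimes> b) \<le> word_length G S (inv b \<otimes> a)"
    if "a \<in> carrier G" "b \<in> carrier G" for a b
    using word_length_inv_le[OF assms(1), of "inv b \<otimes> a"] that by (simp add: inv_mult_group)
  from this[OF assms(2,3)] this[OF assms(3,2)] show ?thesis by (simp add: word_dist_def)
qed

lemma word_dist_triangle:
  assumes "generating_set G S" "x \<in> carrier G" "y \<in> carrier G" "z \<in> carrier G"
  shows "word_dist G S x z \<le> word_dist G S x y + word_dist G S y z"
proof -
  have "y \<otimes> (inv y \<otimes> z) = z"
    using assms by (simp add: m_assoc[symmetric])
  then have "(inv x \<otimes> y) \<otimes> (inv y \<otimes> z) = inv x \<otimes> z"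
    using assms by (simp add: m_assoc)
  then show ?thesis
    using word_length_mult[OF assms(1), of "inv x \<otimes> y" "inv y \<otimes> z"] assms(2-4)
    by (simp add: word_dist_def)
qed

text \<open>This is how coarse inverses enter: with \<open>y\<close> and \<open>y'\<close> the images of \<open>x\<close> and \<open>x'\<close> under a
  map close to the identity, or vice versa, applying that map costs only an additive constant.\<close>

lemma word_dist_perturb:
  assumes gen: "generating_set G S"
    and car: "x \<in> carrier G" "x' \<in> carrier G" "y \<in> carrier G" "y' \<in> carrier G"
    and near: "word_dist G S x y \<le> D" "word_dist G S x' y' \<le> D"
  shows "word_dist G S y y' \<le> word_dist G S x x' + 2 * D"
  using word_dist_triangle[OF gen car(3,1,4)] word_dist_triangle[OF gen car(1,2,4)]
    word_dist_sym[OF gen car(1,3)] near by linarith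

lemma word_dist_left_mult:
  assumes "k \<in> carrier G" "g \<in> carrier G" "h \<in> carrier G"
  shows "word_dist G S (k \<otimes> g) (k \<otimes> h) = word_dist G S g h"
proof -
  have "inv k \<otimes> (k \<otimes> h) = h" using assms by (simp add: m_assoc[symmetric])
  then have "inv (k \<otimes> g) \<otimes> (k \<otimes> h) = inv g \<otimes> h"
    using assms by (simp add: inv_mult_group m_assoc)
  then show ?thesis by (simp add: word_dist_def)
qed

lemma word_dist_edge:
  assumes "generating_set G S" "g \<in> carrier G" "s \<in> S"
  shows "word_dist G S g (g \<otimes> s) \<le> 1"
proof -
  have "s \<in> carrier G" using assms by (auto simp: generating_set_def)
  then have "inv g \<otimes> (g \<otimes> s) = s" using assms by (simp add: m_assoc[symmetric])
  then show ?thesis using word_length_generator[OF assms(1,3)] by (simp add: word_dist_def)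
qed

end

text \<open>A geodesic from \<open>g\<close> to \<open>h\<close> has \<open>word_dist G S g h\<close> edges. Traversed backwards, an edge
  labelled \<open>s\<close> becomes one labelled by the inverse of \<open>s\<close>; it contributes the same displacement
  because the metric on the target is symmetric.\<close>

lemma word_dist_lipschitz_of_edges:
  assumes "group G" "group H"
    and genG: "generating_set G S" and genH: "generating_set H T"
    and f: "f \<in> carrier G \<rightarrow> carrier H"
    and edge: "\<And>g s. g \<in> carrier G \<Longrightarrow> s \<in> S \<Longrightarrow> word_dist H T (f g) (f (g \<otimes>\<^bsub>G\<^esub> s)) \<le> K"
    and "g \<in> carrier G" "h \<in> carrier G"
  shows "word_dist H T (f g) (f h) \<le> K * word_dist G S g h"
proof -
  interpret G: group G by fact
  interpret H: group H by fact
  have S: "S \<subseteq> carrier G" using genG by (simp add: generating_set_def)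
  have letter: "word_dist H T (f g) (f (g \<otimes>\<^bsub>G\<^esub> a)) \<le> K"
    if g: "g \<in> carrier G" and a: "a \<in> letters G S" for g a
  proof (cases "a \<in> S")
    case False
    then obtain s where s: "s \<in> S" "a = inv\<^bsub>G\<^esub> s" using a by blast
    then have "s \<in> carrier G" using S by blast
    then have ga: "g \<otimes>\<^bsub>G\<^esub> a \<in> carrier G" "(g \<otimes>\<^bsub>G\<^esub> a) \<otimes>\<^bsub>G\<^esub> s = g"
      using s g by (simp_all add: G.m_assoc)
    have "word_dist H T (f (g \<otimes>\<^bsub>G\<^esub> a)) (f g) \<le> K"
      using edge[OF ga(1) s(1)] ga(2) by simp
    then show ?thesis
      using H.word_dist_sym[OF genH, of "f g" "f (g \<otimes>\<^bsub>G\<^esub> a)"] funcset_mem[OF f] g ga(1) by simp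
  qed (use edge g in blast)
  have word: "word_dist H T (f g) (f (g \<otimes>\<^bsub>G\<^esub> word_product G ws)) \<le> K * real (length ws)"
    if "set ws \<subseteq> letters G S" "g \<in> carrier G" for ws g
    using that
  proof (induction ws arbitrary: g)
    case Nil
    then show ?case using f H.word_dist_self[of "f g"] by (auto simp: Pi_iff)
  next
    case (Cons a ws)
    have a: "a \<in> letters G S" "a \<in> carrier G" and ws: "set ws \<subseteq> letters G S"
      using Cons.prems S by auto
    define p where "p = word_product G ws"
    have p: "p \<in> carrier G" unfolding p_def using G.word_product_closed[OF S ws] .
    have ga: "g \<otimes>\<^bsub>G\<^esub> a \<in> carrier G" using a Cons.prems by simp
    have "word_dist H T (f (g \<otimes>\<^bsub>G\<^esub> a)) (f (g \<otimes>\<^bsub>G\<^esub> (a \<otimes>\<^bsub>G\<^esub> p))) \<le> K * real (length ws)"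
      using Cons.IH[OF ws ga] a p Cons.prems(2) by (simp add: p_def G.m_assoc)
    moreover have "f g \<in> carrier H" "f (g \<otimes>\<^bsub>G\<^esub> a) \<in> carrier H" "f (g \<otimes>\<^bsub>G\<^esub> (a \<otimes>\<^bsub>G\<^esub> p)) \<in> carrier H"
      using f a p Cons.prems(2) by (auto simp: Pi_iff)
    ultimately have "word_dist H T (f g) (f (g \<otimes>\<^bsub>G\<^esub> (a \<otimes>\<^bsub>G\<^esub> p))) \<le> K + K * real (length ws)"
      using H.word_dist_triangle[OF genH, of "f g" "f (g \<otimes>\<^bsub>G\<^esub> a)" "f (g \<otimes>\<^bsub>G\<^esub> (a \<otimes>\<^bsub>G\<^esub> p))"]
        letter[OF Cons.prems(2) a(1)] by linarith
    then show ?case by (simp add: p_def algebra_simps)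
  qed
  obtain ws where ws: "length ws = word_length G S (inv\<^bsub>G\<^esub> g \<otimes>\<^bsub>G\<^esub> h)" "set ws \<subseteq> letters G S"
    "word_product G ws = inv\<^bsub>G\<^esub> g \<otimes>\<^bsub>G\<^esub> h"
    using G.geodesic_word[OF genG G.m_closed[OF G.inv_closed[OF assms(7)] assms(8)]] .
  have "g \<otimes>\<^bsub>G\<^esub> (inv\<^bsub>G\<^esub> g \<otimes>\<^bsub>G\<^esub> h) = h"
    using assms(7,8) by (simp add: G.m_assoc[symmetric])
  then show ?thesis
    using word[OF ws(2) assms(7)] ws by (simp add: word_dist_def)
qed

section \<open>From a quasi-isometry to a uniform quasi-action\<close>

text \<open>Passing from \<open>h\<close> to \<open>qbar h\<close> and, after a translation by \<open>g\<close>, back to \<open>H\<close> each costs one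
  multiplicative constant \<open>L\<close>, whence \<open>L * L\<close>. The additive constant collects the errors of both
  passages and of the coarse inverse; \<open>g\<close> contributes nothing to either because left translation
  preserves the word metric.\<close>

lemma uniform_of_quasi_isometry:
  assumes "group G" "group H"
    and genG: "generating_set G S" and genH: "generating_set H T"
    and qi: "cayley_quasi_isometry G S H T q"
    and qinv: "quasi_inverse (carrier G) (word_dist G S) (carrier H) (word_dist H T) q qbar"
  shows "uniform_induced_quasi_action G H q qbar T"
proof -
  interpret G: group G by fact
  interpret H: group H by fact
  let ?dG = "word_dist G S" and ?dH = "word_dist H T"
  obtain L C where L: "L \<ge> 1" and C: "C \<ge> 0"
    and LC: "LC_quasi_isometry L C (carrier G) ?dG (carrier H) ?dH q"
    using qi unfolding quasi_isometry_def by blast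
  have q: "q x \<in> carrier H" if "x \<in> carrier G" for x
    using LC that by (auto simp: LC_quasi_isometry_def)
  have lower: "?dG x x' / L - C \<le> ?dH (q x) (q x')"
    and upper: "?dH (q x) (q x') \<le> L * ?dG x x' + C"
    if "x \<in> carrier G" "x' \<in> carrier G" for x x'
    using LC that by (auto simp: LC_quasi_isometry_def)
  have dense: "\<exists>x\<in>carrier G. ?dH (q x) y \<le> C" if "y \<in> carrier H" for y
    using LC that by (auto simp: LC_quasi_isometry_def)
  obtain D where qbar: "\<And>y. y \<in> carrier H \<Longrightarrow> qbar y \<in> carrier G"
    and DG: "\<And>x. x \<in> carrier G \<Longrightarrow> ?dG (qbar (q x)) x \<le> D"
    and DH: "\<And>y. y \<in> carrier H \<Longrightarrow> ?dH (q (qbar y)) y \<le> D"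
    using qinv unfolding quasi_inverse_def by (auto simp: Pi_iff)
  have D: "D \<ge> 0"
    using DG[OF G.one_closed] by (simp add: word_dist_def)
  define C' where "C' = L * L * (2 * D + C) + L * D + 2 * C"
  have LL: "1 \<le> L * L" using L mult_mono[of 1 L 1 L] by simp
  have C': "L * L * (2 * D + C) + C \<le> C'" "L * D + 2 * C \<le> C'" "0 \<le> C'"
    using L C D LL by (simp_all add: C'_def)
  have "LC_quasi_isometry (L * L) C' (carrier H) ?dH (carrier H) ?dH (induced_quasi_action G q qbar g)"
    if g: "g \<in> carrier G" for g
    unfolding LC_quasi_isometry_def induced_quasi_action_def
  proof (intro conjI ballI)
    show "(\<lambda>h. q (g \<otimes>\<^bsub>G\<^esub> qbar h)) \<in> carrier H \<rightarrow> carrier H"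
      using q qbar g by simp
  next
    fix h h' assume h: "h \<in> carrier H" "h' \<in> carrier H"
    have x: "qbar h \<in> carrier G" "qbar h' \<in> carrier G" using qbar h by auto
    have inv: "?dG (g \<otimes>\<^bsub>G\<^esub> qbar h) (g \<otimes>\<^bsub>G\<^esub> qbar h') = ?dG (qbar h) (qbar h')"
      using G.word_dist_left_mult[OF g x] .
    have near: "?dH (q (qbar h)) h \<le> D" "?dH (q (qbar h')) h' \<le> D"
      "?dH h (q (qbar h)) \<le> D" "?dH h' (q (qbar h')) \<le> D"
      using DH h H.word_dist_sym[OF genH] q x by metis+
    have le1: "?dH h h' \<le> ?dH (q (qbar h)) (q (qbar h')) + 2 * D"
      using H.word_dist_perturb[OF genH q[OF x(1)] q[OF x(2)] h near(1,2)] .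
    have le2: "?dH (q (qbar h)) (q (qbar h')) \<le> ?dH h h' + 2 * D"
      using H.word_dist_perturb[OF genH h q[OF x(1)] q[OF x(2)] near(3,4)] .
    have "?dH h h' / (L * L) - C' \<le> ?dG (qbar h) (qbar h') / L - C"
    proof -
      have "?dH h h' \<le> L * ?dG (qbar h) (qbar h') + (C + 2 * D)"
        using le1 upper[OF x] by linarith
      then have "?dH h h' / (L * L) \<le> (L * ?dG (qbar h) (qbar h') + (C + 2 * D)) / (L * L)"
        using LL by (intro divide_right_mono) auto
      also have "\<dots> = ?dG (qbar h) (qbar h') / L + (C + 2 * D) / (L * L)"
        using L by (simp add: add_divide_distrib)
      also have "(C + 2 * D) / (L * L) \<le> C + 2 * D"
        using LL C D divide_left_mono[of 1 "L * L" "C + 2 * D"] by simp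
      also have "C + 2 * D \<le> L * L * (2 * D + C)"
        using mult_right_mono[OF LL, of "2 * D + C"] C D by simp
      finally show ?thesis using C'(1) by linarith
    qed
    also have "\<dots> \<le> ?dH (q (g \<otimes>\<^bsub>G\<^esub> qbar h)) (q (g \<otimes>\<^bsub>G\<^esub> qbar h'))"
      using lower[of "g \<otimes>\<^bsub>G\<^esub> qbar h" "g \<otimes>\<^bsub>G\<^esub> qbar h'"] g x inv by simp
    finally show "?dH h h' / (L * L) - C' \<le> ?dH (q (g \<otimes>\<^bsub>G\<^esub> qbar h)) (q (g \<otimes>\<^bsub>G\<^esub> qbar h'))" .
    have "?dH (q (g \<otimes>\<^bsub>G\<^esub> qbar h)) (q (g \<otimes>\<^bsub>G\<^esub> qbar h')) \<le> L * ?dG (qbar h) (qbar h') + C"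
      using upper[of "g \<otimes>\<^bsub>G\<^esub> qbar h" "g \<otimes>\<^bsub>G\<^esub> qbar h'"] g x inv by simp
    also have "?dG (qbar h) (qbar h') / L \<le> ?dH h h' + 2 * D + C"
      using lower[OF x] le2 by linarith
    then have "?dG (qbar h) (qbar h') \<le> L * (?dH h h' + 2 * D + C)"
      using L by (simp add: pos_divide_le_eq mult.commute)
    then have "L * ?dG (qbar h) (qbar h') + C \<le> L * (L * (?dH h h' + 2 * D + C)) + C"
      using L by simp
    also have "\<dots> = L * L * ?dH h h' + (L * L * (2 * D + C) + C)"
      by (simp add: algebra_simps)
    finally show "?dH (q (g \<otimes>\<^bsub>G\<^esub> qbar h)) (q (g \<otimes>\<^bsub>G\<^esub> qbar h')) \<le> L * L * ?dH h h' + C'"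
      using C'(1) by linarith
  next
    fix y assume y: "y \<in> carrier H"
    then obtain x where x: "x \<in> carrier G" "?dH (q x) y \<le> C" using dense by blast
    \<comment> \<open>Translate a preimage of \<open>y\<close> back by \<open>g\<close> before pushing it forward to \<open>H\<close>.\<close>
    define z where "z = inv\<^bsub>G\<^esub> g \<otimes>\<^bsub>G\<^esub> x"
    have z: "z \<in> carrier G" "g \<otimes>\<^bsub>G\<^esub> z = x"
      using g x by (simp_all add: z_def G.m_assoc[symmetric])
    have w: "qbar (q z) \<in> carrier G" using qbar q z by blast
    have "?dG (g \<otimes>\<^bsub>G\<^esub> qbar (q z)) x \<le> D"
      using G.word_dist_left_mult[OF g w z(1), of S] DG[OF z(1)] z(2) by simp
    then have "L * ?dG (g \<otimes>\<^bsub>G\<^esub> qbar (q z)) x \<le> L * D"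
      using L by (intro mult_left_mono) auto
    then have "?dH (q (g \<otimes>\<^bsub>G\<^esub> qbar (q z))) (q x) \<le> L * D + C"
      using upper[of "g \<otimes>\<^bsub>G\<^esub> qbar (q z)" x] g w x by simp
    then have "?dH (q (g \<otimes>\<^bsub>G\<^esub> qbar (q z))) y \<le> C'"
      using H.word_dist_triangle[OF genH, of "q (g \<otimes>\<^bsub>G\<^esub> qbar (q z))" "q x" y] x(2) C'(2)
        q g w x(1) y by fastforce
    then show "\<exists>h\<in>carrier H. ?dH (q (g \<otimes>\<^bsub>G\<^esub> qbar h)) y \<le> C'"
      using q z by blast
  qed
  then show ?thesis
    unfolding uniform_induced_quasi_action_def using LL C'(3) by blast
qed

section \<open>From a uniform quasi-action to a quasi-isometry\<close>

text \<open>Right translation by \<open>s\<close> sends each vertex to its neighbour along the edge labelled \<open>s\<close>, so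
  this is the largest set of labels for which \<open>f\<close> stretches no edge beyond \<open>K\<close>.\<close>

definition bounded_displacement ::
  "('a, 'm) monoid_scheme \<Rightarrow> ('b \<Rightarrow> 'b \<Rightarrow> real) \<Rightarrow> ('a \<Rightarrow> 'b) \<Rightarrow> real \<Rightarrow> 'a set" where
  "bounded_displacement G d f K =
     {s \<in> carrier G. \<forall>g\<in>carrier G. d (f g) (f (g \<otimes>\<^bsub>G\<^esub> s)) \<le> K}"

text \<open>The set \<open>S\<close> must be large enough to contain \<open>(qbar h)\<inverse> (qbar (h t))\<close> for every edge of the
  Cayley graph of \<open>T\<close>, and small enough that \<open>q\<close> stays Lipschitz. A set of bounded displacement
  meets the second demand by definition, and uniformity of the quasi-action is what the first one
  asks for, because \<open>k (qbar h)\<inverse>\<close> runs through all of \<open>G\<close> as \<open>k\<close> does.\<close>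

lemma quasi_isometry_of_uniform:
  assumes "group G" "group H"
    and genG: "generating_set G S0" and genH0: "generating_set H T0"
    and qi: "cayley_quasi_isometry G S0 H T0 q"
    and qinv: "quasi_inverse (carrier G) (word_dist G S0) (carrier H) (word_dist H T0) q qbar"
    and T: "T0 \<subseteq> T" "T \<subseteq> carrier H"
    and unif: "uniform_induced_quasi_action G H q qbar T"
  shows "\<exists>S. S0 \<subseteq> S \<and> S \<subseteq> carrier G \<and> cayley_quasi_isometry G S H T q"
proof -
  interpret G: group G by fact
  interpret H: group H by fact
  have genH: "generating_set H T" using H.generating_set_superset[OF genH0 T] .
  let ?d = "word_dist H T"
  obtain L0 C0 where L0: "L0 \<ge> 1" and C0: "C0 \<ge> 0"
    and LC0: "LC_quasi_isometry L0 C0 (carrier G) (word_dist G S0) (carrier H) (word_dist H T0) q"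
    using qi unfolding quasi_isometry_def by blast
  have q: "q x \<in> carrier H" if "x \<in> carrier G" for x
    using LC0 that by (auto simp: LC_quasi_isometry_def)
  obtain D where qbar: "\<And>y. y \<in> carrier H \<Longrightarrow> qbar y \<in> carrier G"
    and DG: "\<And>x. x \<in> carrier G \<Longrightarrow> word_dist G S0 (qbar (q x)) x \<le> D"
    using qinv unfolding quasi_inverse_def by (auto simp: Pi_iff)
  obtain L C where L: "L \<ge> 1" and C: "C \<ge> 0"
    and LC: "\<And>g. g \<in> carrier G \<Longrightarrow>
      LC_quasi_isometry L C (carrier H) ?d (carrier H) ?d (induced_quasi_action G q qbar g)"
    using unif unfolding uniform_induced_quasi_action_def by blast
  \<comment> \<open>The first bound puts \<open>S0\<close> into \<open>S\<close>; the second makes \<open>qbar\<close> 1-Lipschitz.\<close>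
  define K where "K = max (L0 + C0) (L + C)"
  have K: "L0 + C0 \<le> K" "L + C \<le> K" "1 \<le> K" using L0 C0 by (auto simp: K_def)
  define S where "S = bounded_displacement G ?d q K"
  have S: "S \<subseteq> carrier G" by (auto simp: S_def bounded_displacement_def)
  have S0: "S0 \<subseteq> S"
  proof
    fix s assume s: "s \<in> S0"
    then have sG: "s \<in> carrier G" using genG by (auto simp: generating_set_def)
    have "?d (q g) (q (g \<otimes>\<^bsub>G\<^esub> s)) \<le> K" if g: "g \<in> carrier G" for g
    proof -
      have gs: "g \<otimes>\<^bsub>G\<^esub> s \<in> carrier G" using g sG by simp
      have "?d (q g) (q (g \<otimes>\<^bsub>G\<^esub> s)) \<le> word_dist H T0 (q g) (q (g \<otimes>\<^bsub>G\<^esub> s))"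
        using H.word_dist_mono[OF genH0 T(1)] q g gs by blast
      also have "\<dots> \<le> L0 * word_dist G S0 g (g \<otimes>\<^bsub>G\<^esub> s) + C0"
        using LC0 g gs by (auto simp: LC_quasi_isometry_def)
      also have "\<dots> \<le> L0 * 1 + C0"
        using G.word_dist_edge[OF genG g s] L0 by (intro add_right_mono mult_left_mono) auto
      finally show ?thesis using K(1) by simp
    qed
    then show "s \<in> S" using sG by (simp add: S_def bounded_displacement_def)
  qed
  have genS: "generating_set G S" using G.generating_set_superset[OF genG S0 S] .
  have q_lipschitz: "?d (q g) (q g') \<le> K * word_dist G S g g'"
    if "g \<in> carrier G" "g' \<in> carrier G" for g g'
    using that q
    by (intro word_dist_lipschitz_of_edges[OF assms(1,2) genS genH])
      (auto simp: S_def bounded_displacement_def)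
  have qbar_edge: "word_dist G S (qbar h) (qbar (h \<otimes>\<^bsub>H\<^esub> t)) \<le> 1"
    if h: "h \<in> carrier H" and t: "t \<in> T" for h t
  proof -
    have ht: "h \<otimes>\<^bsub>H\<^esub> t \<in> carrier H" using h t T by auto
    have x: "qbar h \<in> carrier G" "qbar (h \<otimes>\<^bsub>H\<^esub> t) \<in> carrier G" using qbar h ht by auto
    define s where "s = inv\<^bsub>G\<^esub> (qbar h) \<otimes>\<^bsub>G\<^esub> qbar (h \<otimes>\<^bsub>H\<^esub> t)"
    have s: "s \<in> carrier G" "qbar h \<otimes>\<^bsub>G\<^esub> s = qbar (h \<otimes>\<^bsub>H\<^esub> t)"
      using x by (simp_all add: s_def G.m_assoc[symmetric])
    have "?d (q k) (q (k \<otimes>\<^bsub>G\<^esub> s)) \<le> K" if k: "k \<in> carrier G" for k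
    proof -
      \<comment> \<open>The element whose quasi-action sends \<open>h\<close> to \<open>q k\<close>.\<close>
      define g where "g = k \<otimes>\<^bsub>G\<^esub> inv\<^bsub>G\<^esub> (qbar h)"
      have g: "g \<in> carrier G" "g \<otimes>\<^bsub>G\<^esub> qbar h = k"
        using k x by (simp_all add: g_def G.m_assoc)
      have gs: "g \<otimes>\<^bsub>G\<^esub> qbar (h \<otimes>\<^bsub>H\<^esub> t) = k \<otimes>\<^bsub>G\<^esub> s"
        using k x by (simp add: g_def s_def G.m_assoc)
      have "?d (q (g \<otimes>\<^bsub>G\<^esub> qbar h)) (q (g \<otimes>\<^bsub>G\<^esub> qbar (h \<otimes>\<^bsub>H\<^esub> t))) \<le> L * ?d h (h \<otimes>\<^bsub>H\<^esub> t) + C"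
        using LC[OF g(1)] h ht by (auto simp: LC_quasi_isometry_def induced_quasi_action_def)
      also have "\<dots> \<le> L * 1 + C"
        using H.word_dist_edge[OF genH h t] L by (intro add_right_mono mult_left_mono) auto
      finally show ?thesis using g(2) gs K(2) by simp
    qed
    then have "s \<in> S" using s(1) by (simp add: S_def bounded_displacement_def)
    from G.word_dist_edge[OF genS x(1) this] show ?thesis using s(2) by simp
  qed
  have qbar_lipschitz: "word_dist G S (qbar h) (qbar h') \<le> ?d h h'"
    if "h \<in> carrier H" "h' \<in> carrier H" for h h'
    using word_dist_lipschitz_of_edges[OF assms(2,1) genH genS _ qbar_edge that] qbar by auto
  have near: "word_dist G S (qbar (q x)) x \<le> D" if "x \<in> carrier G" for x
    using G.word_dist_mono[OF genG S0] DG q qbar that by (meson order_trans)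
  define C' where "C' = max C0 (2 * D)"
  have C': "C0 \<le> C'" "2 * D \<le> C'" "0 \<le> C'" using C0 by (auto simp: C'_def)
  have "LC_quasi_isometry K C' (carrier G) (word_dist G S) (carrier H) ?d q"
    unfolding LC_quasi_isometry_def
  proof (intro conjI ballI)
    show "q \<in> carrier G \<rightarrow> carrier H" using q by blast
  next
    fix x x' assume x: "x \<in> carrier G" "x' \<in> carrier G"
    show "?d (q x) (q x') \<le> K * word_dist G S x x' + C'"
      using q_lipschitz[OF x] C'(3) by linarith
    have "word_dist G S x x' / K \<le> word_dist G S x x' / 1"
      using K(3) by (intro divide_left_mono) (auto simp: word_dist_def)
    also have "\<dots> \<le> word_dist G S (qbar (q x)) (qbar (q x')) + 2 * D"
      using G.word_dist_perturb[OF genS _ _ x near[OF x(1)] near[OF x(2)]] q qbar x by simp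
    also have "\<dots> \<le> ?d (q x) (q x') + C'"
      using qbar_lipschitz[OF q[OF x(1)] q[OF x(2)]] C'(2) by linarith
    finally show "word_dist G S x x' / K - C' \<le> ?d (q x) (q x')" by linarith
  next
    fix y assume y: "y \<in> carrier H"
    then obtain x where x: "x \<in> carrier G" "word_dist H T0 (q x) y \<le> C0"
      using LC0 by (auto simp: LC_quasi_isometry_def)
    have "?d (q x) y \<le> word_dist H T0 (q x) y"
      using H.word_dist_mono[OF genH0 T(1) q[OF x(1)] y] .
    then show "\<exists>x\<in>carrier G. ?d (q x) y \<le> C'" using x C'(1) by force
  qed
  then have "cayley_quasi_isometry G S H T q"
    unfolding quasi_isometry_def using K(3) C'(3) by blast
  then show ?thesis using S S0 by blast
qed

section \<open>The equivalence\<close>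

text \<open>Being coarsely inverse only bounds distances from above, and these shrink when the generating
  sets grow. (Being a quasi-isometry also bounds them from below and is not inherited.)\<close>

lemma quasi_inverse_superset:
  assumes "group G" "group H" and genG: "generating_set G S0" and genH: "generating_set H T0"
    and "S0 \<subseteq> S" "T0 \<subseteq> T" and q: "q \<in> carrier G \<rightarrow> carrier H"
    and qinv: "quasi_inverse (carrier G) (word_dist G S0) (carrier H) (word_dist H T0) q qbar"
  shows "quasi_inverse (carrier G) (word_dist G S) (carrier H) (word_dist H T) q qbar"
proof -
  obtain D where qbar: "qbar \<in> carrier H \<rightarrow> carrier G"
    and "\<forall>x\<in>carrier G. word_dist G S0 (qbar (q x)) x \<le> D"
    and "\<forall>y\<in>carrier H. word_dist H T0 (q (qbar y)) y \<le> D"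
    using qinv unfolding quasi_inverse_def by blast
  then have "\<forall>x\<in>carrier G. word_dist G S (qbar (q x)) x \<le> D"
    and "\<forall>y\<in>carrier H. word_dist H T (q (qbar y)) y \<le> D"
    using group.word_dist_mono[OF \<open>group G\<close> genG \<open>S0 \<subseteq> S\<close>]
      group.word_dist_mono[OF \<open>group H\<close> genH \<open>T0 \<subseteq> T\<close>] q
    by (meson PiE order_trans)+
  then show ?thesis unfolding quasi_inverse_def using qbar by blast
qed

theorem propositionC:
  fixes G :: "('a, 'm) monoid_scheme" and H :: "('b, 'n) monoid_scheme"
    and S0 :: "'a set" and T0 T :: "'b set"
    and q :: "'a \<Rightarrow> 'b" and qbar :: "'b \<Rightarrow> 'a"
  assumes "group G" and "group H"
    and "finite S0" and "generating_set G S0"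
    and "finite T0" and "generating_set H T0"
    and "cayley_quasi_isometry G S0 H T0 q"
    and "quasi_inverse (carrier G) (word_dist G S0) (carrier H) (word_dist H T0) q qbar"
    and "T0 \<subseteq> T" and "T \<subseteq> carrier H"
  shows "uniform_induced_quasi_action G H q qbar T \<longleftrightarrow>
         (\<exists>S. S0 \<subseteq> S \<and> S \<subseteq> carrier G \<and> cayley_quasi_isometry G S H T q)"
proof
  assume "uniform_induced_quasi_action G H q qbar T"
  then show "\<exists>S. S0 \<subseteq> S \<and> S \<subseteq> carrier G \<and> cayley_quasi_isometry G S H T q"
    by (rule quasi_isometry_of_uniform[OF assms(1,2,4,6-10)])
next
  assume "\<exists>S. S0 \<subseteq> S \<and> S \<subseteq> carrier G \<and> cayley_quasi_isometry G S H T q"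
  then obtain S where S: "S0 \<subseteq> S" "S \<subseteq> carrier G" and qi: "cayley_quasi_isometry G S H T q"
    by blast
  have q: "q \<in> carrier G \<rightarrow> carrier H"
    using qi unfolding quasi_isometry_def LC_quasi_isometry_def by blast
  have "generating_set G S" "generating_set H T"
    using group.generating_set_superset assms(1,2,4,6,9,10) S by blast+
  then show "uniform_induced_quasi_action G H q qbar T"
    using uniform_of_quasi_isometry[OF assms(1,2) _ _ qi]
      quasi_inverse_superset[OF assms(1,2,4,6) S(1) assms(9) q assms(8)] by blast
qed

end
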